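(* Consider the system $$X_0(t)=0,\qquad \dot{X}_n(t)=k_{n-1}X_{n-1}^2(t)-k_nX_n(t)X_{n+1}(t)\quad (n\ge 1),\qquad k_n=2^n.$$ Given $t_0<0$, there exists a unique positive finite energy self-similar solution $X_n(t)=\frac{a_n}{t-t_0}$ with $a_1\ne0$. In general, given $t_0<0$ and an integer $n_0\ge0$, there exists a unique positive finite energy self-similar solution $X_n(t)=\frac{a_n}{t-t_0}$ with $$a_1=\dots=a_{n_0}=0,\qquad a_{n_0+1}\neq0$$ (where the first conditions are meaningful only for $n_0>0$). In addition, the coefficients $a_n$ have the property $$\lim_{n\to\infty}\frac{a_n}{k_n^{-1/3}}=C_{n_0},$$ where $C_{n_0}=2^{-2n_0/3}R^{-1}$ for a constant $R\in(4/5,1)$ that does not depend on $n_0$ or $t_0$.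
   Context: For $t_0<0$, a self-similar solution is a solution of the form $X_n(t)=\frac{a_n}{t-t_0}$, $t>t_0$, $n\ge1$, with real coefficients $a_n$ (and $a_0=0$), satisfying all equations of the system for $t>t_0$ (in particular on $[0,\infty)$). It has finite energy if $\sum_{n\ge1}a_n^2<\infty$. It is positive if all components are non-negative, i.e. $a_n\ge0$ for all $n$. *)

theory Defs
  imports "HOL-Analysis.Analysis"
begin

definition dyadic_k :: "nat \<Rightarrow> real" where
  "dyadic_k n = 2 ^ n"

definition dyadic_solution_on :: "real set \<Rightarrow> (nat \<Rightarrow> real \<Rightarrow> real) \<Rightarrow> bool" where
  "dyadic_solution_on I X \<longleftrightarrow>
     (\<forall>t\<in>I. X 0 t = 0) \<and>
     (\<forall>n\<ge>1. \<forall>t\<in>I.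
        (X n has_real_derivative
           (dyadic_k (n - 1) * (X (n - 1) t)\<^sup>2 - dyadic_k n * X n t * X (n + 1) t))
        (at t within I))"

text \<open>A self-similar solution is represented by its coefficient sequence; for fixed \<open>t0\<close>, the
  coefficients and the values of the solution on \<open>{t0<..}\<close> determine each other.\<close>

definition self_similar_solution :: "real \<Rightarrow> (nat \<Rightarrow> real) \<Rightarrow> bool" where
  "self_similar_solution t0 a \<longleftrightarrow>
     a 0 = 0 \<and> dyadic_solution_on {t0<..} (\<lambda>n t. a n / (t - t0))"

definition finite_energy :: "(nat \<Rightarrow> real) \<Rightarrow> bool" where
  "finite_energy a \<longleftrightarrow> summable (\<lambda>n. (a (Suc n))\<^sup>2)"

definition positive_finite_energy_self_similar :: "real \<Rightarrow> (nat \<Rightarrow> real) \<Rightarrow> bool" where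
  "positive_finite_energy_self_similar t0 a \<longleftrightarrow>
     self_similar_solution t0 a \<and> (\<forall>n. 0 \<le> a n) \<and> finite_energy a"

end

theory Submission
  imports Defs
begin

text \<open>
  Inserting \<open>X\<^sub>n = a\<^sub>n / (t - t0)\<close> into the system gives
  \<open>2\<^sup>n a\<^sub>n a\<^sub>n\<^sub>+\<^sub>1 = a\<^sub>n + 2\<^sup>n\<^sup>-\<^sup>1 a\<^sub>n\<^sub>-\<^sub>1\<^sup>2\<close>, a one-parameter family of positive sequences indexed by \<open>a\<^sub>1\<close>.

  Uniqueness: the differences of two such sequences alternate in sign, and with \<open>D\<^sub>n\<close> their absolute
  values and \<open>m\<^sub>n\<close> the averages, \<open>m\<^sub>n D\<^sub>n D\<^sub>n\<^sub>+\<^sub>1\<close> is nondecreasing and eventually positive; this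
  is impossible when both sequences tend to \<open>0\<close>.

  Existence: with \<open>\<delta> = 2\<^sup>-\<^sup>1\<^sup>/\<^sup>3\<close> and \<open>a\<^sub>n = \<delta>\<^sup>n u\<^sub>n\<close> the recursion becomes
  \<open>u\<^sub>n\<^sub>+\<^sub>1 = \<epsilon>\<^sub>n + u\<^sub>n\<^sub>-\<^sub>1\<^sup>2 / u\<^sub>n\<close> with \<open>\<epsilon>\<^sub>n = \<delta>\<^sup>2\<^sup>n\<^sup>-\<^sup>1\<close>. A shooting argument on \<open>u\<^sub>1\<close> yields a monotone
  solution: where \<open>u\<^sub>N = u\<^sub>N\<^sub>+\<^sub>1\<close> one has \<open>u\<^sub>N\<^sub>+\<^sub>2 > u\<^sub>N\<^sub>+\<^sub>1\<close>, and where \<open>u\<^sub>N\<^sub>-\<^sub>1 = u\<^sub>N\<close> one has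
  \<open>u\<^sub>N\<^sub>+\<^sub>2 \<le> u\<^sub>N\<^sub>+\<^sub>1\<close>, so the parameter intervals can be nested. Monotonicity gives
  \<open>u\<^sub>n\<^sub>+\<^sub>1 \<le> u\<^sub>n + \<epsilon>\<^sub>n\<close>, so \<open>u\<close> converges, and the energy flux identity
  \<open>u\<^sub>n\<^sup>2 u\<^sub>n\<^sub>+\<^sub>1 - u\<^sub>n\<^sub>-\<^sub>1\<^sup>2 u\<^sub>n = \<epsilon>\<^sub>n u\<^sub>n\<^sup>2\<close> locates the limit in \<open>(1, 5/4)\<close>.
  Solutions with \<open>n0\<close> leading zeros are shifts of this one, scaled by \<open>2\<^sup>-\<^sup>n\<^sup>0\<close>.
\<close>

section \<open>Reduction of the system to a recursion for the coefficients\<close>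

definition coeff_eq :: "(nat \<Rightarrow> real) \<Rightarrow> bool" where
  "coeff_eq a \<longleftrightarrow> a 0 = 0 \<and>
     (\<forall>n. 2 ^ Suc n * a (Suc n) * a (Suc (Suc n)) = a (Suc n) + 2 ^ n * (a n)\<^sup>2)"

lemma coeff_eqD:
  assumes "coeff_eq a"
  shows "2 ^ Suc n * a (Suc n) * a (Suc (Suc n)) = a (Suc n) + 2 ^ n * (a n)\<^sup>2"
  using assms by (simp add: coeff_eq_def)

text \<open>Derivatives on the open half line are unique, and both sides of each equation carry the
  factor \<open>1 / (t - t0)\<^sup>2\<close>, so time cancels.\<close>

lemma self_similar_solution_iff: "self_similar_solution t0 a \<longleftrightarrow> coeff_eq a"
proof -
  have from_1: "(\<forall>n\<ge>1. P n) \<longleftrightarrow> (\<forall>n. P (Suc n))" for P :: "nat \<Rightarrow> bool"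
    by (metis One_nat_def Suc_le_D le_add1 plus_1_eq_Suc)
  have deriv: "((\<lambda>t. a n / (t - t0)) has_real_derivative - a n / (t - t0)\<^sup>2) (at t within {t0<..})"
    if "t > t0" for t n
    using that by (auto intro!: derivative_eq_intros simp: power2_eq_square)
  have "((\<lambda>t. a n / (t - t0)) has_real_derivative d) (at t within {t0<..}) \<longleftrightarrow> d = - a n / (t - t0)\<^sup>2"
    if "t > t0" for t n d
  proof
    assume "((\<lambda>t. a n / (t - t0)) has_real_derivative d) (at t within {t0<..})"
    then have "((\<lambda>t. a n / (t - t0)) has_real_derivative d) (at t)"
      using that by (simp add: at_within_open[of t "{t0<..}"])
    moreover have "((\<lambda>t. a n / (t - t0)) has_real_derivative - a n / (t - t0)\<^sup>2) (at t)"
      using deriv[OF that] that by (simp add: at_within_open[of t "{t0<..}"])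
    ultimately show "d = - a n / (t - t0)\<^sup>2" by (rule DERIV_unique)
  qed (use deriv that in simp)
  then have "dyadic_solution_on {t0<..} (\<lambda>n t. a n / (t - t0)) \<longleftrightarrow>
     (\<forall>t>t0. a 0 / (t - t0) = 0) \<and>
     (\<forall>n\<ge>1. \<forall>t>t0. 2 ^ (n - 1) * (a (n - 1) / (t - t0))\<^sup>2
        - 2 ^ n * (a n / (t - t0)) * (a (n + 1) / (t - t0)) = - a n / (t - t0)\<^sup>2)"
    unfolding dyadic_solution_on_def dyadic_k_def by auto
  also have "\<dots> \<longleftrightarrow> (\<forall>t>t0. a 0 = 0) \<and>
     (\<forall>n\<ge>1. \<forall>t>t0. 2 ^ (n - 1) * (a (n - 1))\<^sup>2 - 2 ^ n * a n * a (n + 1) = - a n)"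
  proof -
    have *: "2 ^ (n - 1) * (a (n - 1) / s)\<^sup>2 - 2 ^ n * (a n / s) * (a (n + 1) / s) = - a n / s\<^sup>2 \<longleftrightarrow>
      2 ^ (n - 1) * (a (n - 1))\<^sup>2 - 2 ^ n * a n * a (n + 1) = - a n" if "s > 0" for s n
    proof -
      have "2 ^ (n - 1) * (a (n - 1) / s)\<^sup>2 - 2 ^ n * (a n / s) * (a (n + 1) / s) =
        (2 ^ (n - 1) * (a (n - 1))\<^sup>2 - 2 ^ n * a n * a (n + 1)) / s\<^sup>2"
        by (simp add: power2_eq_square diff_divide_distrib)
      then show ?thesis using that by (simp only: divide_cancel_right) simp
    qed
    have "t > t0 \<Longrightarrow> a 0 / (t - t0) = 0 \<longleftrightarrow> a 0 = 0" for t by simp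
    then show ?thesis using *[of "_ - t0"] by (metis diff_gt_0_iff_gt)
  qed
  also have "\<dots> \<longleftrightarrow> a 0 = 0 \<and> (\<forall>n\<ge>1. 2 ^ (n - 1) * (a (n - 1))\<^sup>2 - 2 ^ n * a n * a (n + 1) = - a n)"
    using gt_ex[of t0] by blast
  also have "(\<forall>n\<ge>1. 2 ^ (n - 1) * (a (n - 1))\<^sup>2 - 2 ^ n * a n * a (n + 1) = - a n) \<longleftrightarrow>
      (\<forall>n. 2 ^ n * (a n)\<^sup>2 - 2 ^ Suc n * a (Suc n) * a (Suc (Suc n)) = - a (Suc n))"
    by (simp only: from_1 diff_Suc_1 Suc_eq_plus1[symmetric])
  finally show ?thesis
    unfolding self_similar_solution_def coeff_eq_def by (auto simp: algebra_simps)
qed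

section \<open>Positivity and uniqueness for the coefficient recursion\<close>

lemma coeff_pos:
  assumes "coeff_eq a" "\<And>n. 0 \<le> a n" "a 1 \<noteq> 0"
  shows "0 < a (Suc n)"
proof (induction n)
  case 0
  then show ?case using assms(2)[of 1] assms(3) by simp
next
  case (Suc n)
  have "0 < a (Suc n) + 2 ^ n * (a n)\<^sup>2"
    using Suc by (simp add: add_pos_nonneg)
  then have "a (Suc (Suc n)) \<noteq> 0"
    using coeff_eqD[OF assms(1), of n] by auto
  then show ?case using assms(2)[of "Suc (Suc n)"] by simp
qed

text \<open>Division of the recursion by \<open>a (Suc n)\<close> leaves 1 plus a nonnegative term,
  which is positive once \<open>a n\<close> is. This fixes the sign of a coefficient in the
  recursion for differences below.\<close>

lemma coeff_lower:
  assumes "coeff_eq a" "\<And>n. 0 \<le> a n" "a 1 \<noteq> 0"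
  shows "1 \<le> 2 ^ Suc n * a (Suc (Suc n))"
    and "n > 0 \<Longrightarrow> 1 < 2 ^ Suc n * a (Suc (Suc n))"
proof -
  have pos: "0 < a (Suc n)" using coeff_pos[OF assms] .
  have eq: "a (Suc n) * (2 ^ Suc n * a (Suc (Suc n))) = a (Suc n) + 2 ^ n * (a n)\<^sup>2"
    using coeff_eqD[OF assms(1), of n] by (simp add: algebra_simps)
  then have "a (Suc n) * 1 \<le> a (Suc n) * (2 ^ Suc n * a (Suc (Suc n)))" by simp
  then show "1 \<le> 2 ^ Suc n * a (Suc (Suc n))" using pos by (simp only: mult_le_cancel_left_pos)
  show "1 < 2 ^ Suc n * a (Suc (Suc n))" if "n > 0"
  proof -
    have "0 < a n" using coeff_pos[OF assms, of "n - 1"] that by simp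
    then have "a (Suc n) * 1 < a (Suc n) * (2 ^ Suc n * a (Suc (Suc n)))" unfolding eq by simp
    then show ?thesis using pos by (simp only: mult_less_cancel_left_pos)
  qed
qed

lemma coeff_not_less:
  assumes a: "coeff_eq a" "\<And>n. 0 \<le> a n" "a 1 \<noteq> 0" "a \<longlonglongrightarrow> 0"
    and b: "coeff_eq b" "\<And>n. 0 \<le> b n" "b 1 \<noteq> 0" "b \<longlonglongrightarrow> 0"
  shows "\<not> a 1 < b 1"
proof
  assume less: "a 1 < b 1"
  define m where "m n = (a n + b n) / 2" for n
  define D where "D n = (- 1) ^ Suc n * (b n - a n)" for n
  have mpos: "0 < m (Suc n)" for n
    using coeff_pos[OF a(1-3), of n] coeff_pos[OF b(1-3), of n] by (simp add: m_def)
  have mge: "0 \<le> m n" for n using a(2)[of n] b(2)[of n] by (simp add: m_def)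
  have mlow: "1 \<le> 2 ^ Suc n * m (Suc (Suc n))" for n
    using coeff_lower(1)[OF a(1-3), of n] coeff_lower(1)[OF b(1-3), of n]
    by (simp add: m_def field_simps)
  \<comment> \<open>The difference of two products is mean times difference plus difference times
    mean. The alternating sign in \<open>D\<close> then makes all coefficients of this linear
    recursion nonnegative.\<close>
  have rec: "2 ^ Suc n * m (Suc n) * D (Suc (Suc n)) =
      D (Suc n) * (2 ^ Suc n * m (Suc (Suc n)) - 1) + 2 ^ Suc n * m n * D n" for n
  proof -
    have "2 ^ Suc n * m (Suc n) * D (Suc (Suc n)) -
      (D (Suc n) * (2 ^ Suc n * m (Suc (Suc n)) - 1) + 2 ^ Suc n * m n * D n) =
      (- 1) ^ Suc n * (2 ^ Suc n * b (Suc n) * b (Suc (Suc n)) - b (Suc n) - 2 ^ n * (b n)\<^sup>2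
        - (2 ^ Suc n * a (Suc n) * a (Suc (Suc n)) - a (Suc n) - 2 ^ n * (a n)\<^sup>2))"
      unfolding m_def D_def by (simp add: field_simps power2_eq_square)
    also have "\<dots> = 0"
      unfolding coeff_eqD[OF a(1), of n] coeff_eqD[OF b(1), of n] by simp
    finally show ?thesis by simp
  qed
  have D0: "D 0 = 0" using a(1) b(1) by (simp add: D_def coeff_eq_def)
  have D1: "0 < D 1" using less by (simp add: D_def)
  have step: "0 \<le> D (Suc (Suc n))" if "0 \<le> D n" "0 \<le> D (Suc n)" for n
  proof -
    have "0 \<le> D (Suc n) * (2 ^ Suc n * m (Suc (Suc n)) - 1) + 2 ^ Suc n * m n * D n"
      using that mlow[of n] mge[of n] by (intro add_nonneg_nonneg mult_nonneg_nonneg) auto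
    then have "0 \<le> 2 ^ Suc n * m (Suc n) * D (Suc (Suc n))" using rec[of n] by simp
    moreover have "0 < 2 ^ Suc n * m (Suc n)" using mpos[of n] by simp
    ultimately show ?thesis by (simp only: zero_le_mult_iff) linarith
  qed
  have Dge2: "0 \<le> D n \<and> 0 \<le> D (Suc n)" for n
  proof (induction n)
    case 0
    then show ?case using D0 D1 by simp
  next
    case (Suc n)
    then show ?case using step by blast
  qed
  then have Dge: "0 \<le> D n" for n by blast
  have grow: "m n * D n \<le> m (Suc n) * D (Suc (Suc n))" for n
  proof -
    have "0 \<le> D (Suc n) * (2 ^ Suc n * m (Suc (Suc n)) - 1)"
      using Dge[of "Suc n"] mlow[of n] by simp
    then have "2 ^ Suc n * (m n * D n) \<le> 2 ^ Suc n * (m (Suc n) * D (Suc (Suc n)))"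
      using rec[of n] by (simp add: mult.assoc)
    then show ?thesis by (simp only: mult_le_cancel_left_pos zero_less_power zero_less_numeral)
  qed
  \<comment> \<open>Both sequences have second coefficient 1/2, so \<open>D 2 = 0\<close> and the
    flux \<open>F\<close> defined below vanishes at 0, 1 and 2. Index 3 is the first where it can be
    positive.\<close>
  have D3: "0 < D 3"
  proof -
    have "0 < m 1 * D 1" using D1 mpos[of 0] by simp
    also have "\<dots> \<le> m 2 * D 3" using grow[of 1] by (simp add: numeral_2_eq_2 numeral_3_eq_3)
    finally show ?thesis using mge[of 2] by (simp add: zero_less_mult_iff)
  qed
  have D4: "0 < D 4"
  proof -
    have "1 < 8 * m 4"
      using coeff_lower(2)[OF a(1-3), of 2] coeff_lower(2)[OF b(1-3), of 2]
      by (simp add: m_def numeral_eq_Suc)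
    then have "0 < D 3 * (8 * m 4 - 1) + 8 * m 2 * D 2"
      using D3 Dge[of 2] mge[of 2] by (intro add_pos_nonneg) auto
    also have "\<dots> = 8 * m 3 * D 4"
      using rec[of 2] by (simp add: numeral_eq_Suc)
    finally show ?thesis using mge[of 3] by (simp add: zero_less_mult_iff)
  qed
  define F where "F n = m n * D n * D (Suc n)" for n
  have "mono F"
  proof (rule mono_iff_le_Suc[THEN iffD2], rule allI)
    fix n
    show "F n \<le> F (Suc n)"
      using mult_right_mono[OF grow[of n] Dge[of "Suc n"]] by (simp add: F_def ac_simps)
  qed
  then have "F 3 \<le> F n" if "n \<ge> 3" for n using that by (simp add: monoD)
  then have ev: "eventually (\<lambda>n. F 3 \<le> F n) sequentially"
    using eventually_sequentially by blast
  have m0: "m \<longlonglongrightarrow> 0"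
    unfolding m_def using tendsto_divide[OF tendsto_add[OF a(4) b(4)] tendsto_const[of 2]] by simp
  have D0': "D \<longlonglongrightarrow> 0"
  proof (rule tendsto_rabs_zero_cancel)
    have "(\<lambda>n. \<bar>b n - a n\<bar>) \<longlonglongrightarrow> 0"
      using tendsto_rabs[OF tendsto_diff[OF b(4) a(4)]] by simp
    then show "(\<lambda>n. \<bar>D n\<bar>) \<longlonglongrightarrow> 0" by (simp add: D_def abs_mult)
  qed
  have "F \<longlonglongrightarrow> 0"
    unfolding F_def using tendsto_mult[OF tendsto_mult[OF m0 D0'] LIMSEQ_Suc[OF D0']] by simp
  then have "F 3 \<le> 0"
    using tendsto_le[OF sequentially_bot _ tendsto_const ev] by blast
  moreover have "0 < F 3" using D3 D4 mpos[of 2] by (simp add: F_def numeral_eq_Suc)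
  ultimately show False by simp
qed

lemma coeff_unique:
  assumes a: "coeff_eq a" "\<And>n. 0 \<le> a n" "a 1 \<noteq> 0" "a \<longlonglongrightarrow> 0"
    and b: "coeff_eq b" "\<And>n. 0 \<le> b n" "b 1 \<noteq> 0" "b \<longlonglongrightarrow> 0"
  shows "a = b"
proof -
  have 1: "a 1 = b 1" using coeff_not_less[OF a b] coeff_not_less[OF b a] by simp
  have "a n = b n \<and> a (Suc n) = b (Suc n)" for n
  proof (induction n)
    case 0
    then show ?case using 1 a(1) b(1) by (simp add: coeff_eq_def)
  next
    case (Suc n)
    have "2 ^ Suc n * a (Suc n) * a (Suc (Suc n)) = 2 ^ Suc n * a (Suc n) * b (Suc (Suc n))"
      using coeff_eqD[OF a(1), of n] coeff_eqD[OF b(1), of n] Suc by simp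
    then show ?case using Suc coeff_pos[OF a(1-3), of n] by simp
  qed
  then show ?thesis by auto
qed

subsection \<open>The rescaled recursion\<close>

definition \<delta> :: real where
  "\<delta> = 2 powr (- (1 / 3))"

lemma \<delta>_pos: "0 < \<delta>" by (simp add: \<delta>_def)

lemma \<delta>_power: "\<delta> ^ n = 2 powr (- (real n / 3))"
  unfolding \<delta>_def by (simp add: powr_realpow[symmetric] powr_powr)

lemma \<delta>_cubed: "\<delta> ^ 3 = 1 / 2"
  unfolding \<delta>_power by (simp add: powr_minus)

lemma \<delta>_less_1: "\<delta> < 1"
proof -
  have "\<delta> ^ 3 < 1 ^ 3" unfolding \<delta>_cubed by simp
  then show ?thesis by (rule power_less_imp_less_base) simp
qed

text \<open>The number is 2 to the power -2/3, about 0.63. The lower bound must exceed 0.618..., the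
  positive root of l^2 + l = 1, in the proof that the limit is above 1.\<close>

lemma \<delta>_square_bounds: "0.62 < \<delta>\<^sup>2" "\<delta>\<^sup>2 < 0.63"
proof -
  have "(\<delta>\<^sup>2) ^ 3 = (\<delta> ^ 3)\<^sup>2" by (simp flip: power_mult)
  then have *: "(\<delta>\<^sup>2) ^ 3 = 1 / 4" unfolding \<delta>_cubed by (simp add: power2_eq_square)
  have "0.62 ^ 3 < (\<delta>\<^sup>2) ^ 3" unfolding * by (simp add: power3_eq_cube)
  then show "0.62 < \<delta>\<^sup>2" by (rule power_less_imp_less_base) simp
  have "(\<delta>\<^sup>2) ^ 3 < 0.63 ^ 3" unfolding * by (simp add: power3_eq_cube)
  then show "\<delta>\<^sup>2 < 0.63" by (rule power_less_imp_less_base) simp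
qed

text \<open>The value at index 2 is \<delta> for every \<open>x\<close>. Since division by zero
  gives 0, this includes \<open>x = 0\<close>, which can therefore serve as an end of the first
  shooting segment.\<close>

fun scaled :: "real \<Rightarrow> nat \<Rightarrow> real" where
  "scaled x 0 = 0"
| "scaled x (Suc 0) = x"
| "scaled x (Suc (Suc n)) = \<delta> ^ (2 * n + 1) + (scaled x n)\<^sup>2 / scaled x (Suc n)"

lemma scaled_ge:
  assumes "0 \<le> x"
  shows "0 \<le> scaled x n" "\<delta> ^ (2 * n + 1) \<le> scaled x (Suc (Suc n))"
proof -
  have nonneg: "0 \<le> scaled x n" for n
    by (induction n rule: induct_nat_012) (use assms \<delta>_pos in \<open>auto intro!: add_nonneg_nonneg\<close>)
  show "0 \<le> scaled x n" by (rule nonneg)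
  show "\<delta> ^ (2 * n + 1) \<le> scaled x (Suc (Suc n))" by (simp add: nonneg)
qed

lemma scaled_pos: "0 \<le> x \<Longrightarrow> 0 < scaled x (Suc (Suc n))"
  by (rule less_le_trans[OF zero_less_power[OF \<delta>_pos] scaled_ge(2)])

text \<open>The only denominator with a zero on the half line is \<open>x\<close> itself, and its
  numerator is identically 0.\<close>

lemma continuous_on_scaled: "continuous_on {0..} (\<lambda>x. scaled x n)"
proof (induction n rule: induct_nat_012)
  case (ge2 n)
  show ?case
  proof (cases n)
    case (Suc k)
    have "\<forall>x\<in>{0..}. scaled x (Suc n) \<noteq> 0"
      using scaled_pos[of _ k] Suc by (metis atLeast_iff less_irrefl)
    then show ?thesis
      using ge2 by (simp only: scaled.simps) (intro continuous_intros)
  qed simp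
qed (auto intro: continuous_intros)

section \<open>Shooting for a monotone profile\<close>

text \<open>The zero nearest to \<open>p\<close> is selected. The order of \<open>p\<close> and
  \<open>q\<close> is left open because the direction of the shooting segments alternates.\<close>

lemma first_sign_change:
  fixes f :: "real \<Rightarrow> real"
  assumes cont: "continuous_on (closed_segment p q) f" and "0 \<le> f p" "f q \<le> 0"
  obtains c where "c \<in> closed_segment p q" "f c = 0" "\<And>x. x \<in> closed_segment p c \<Longrightarrow> 0 \<le> f x"
proof -
  define h where "h t = p + t * (q - p)" for t :: real
  have seg: "closed_segment p (h s) = h ` {0..s}" if "0 \<le> s" for s
  proof -
    have "closed_segment p (h s) = (\<lambda>u. h (u * s)) ` {0..1}"
      unfolding closed_segment_image_interval h_def
      by (intro image_cong) (auto simp: algebra_simps)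
    also have "\<dots> = h ` ((\<lambda>u. u * s) ` {0..1})" by (simp add: image_image)
    also have "(\<lambda>u. u * s) ` {0..1} = {0..s}"
      using that by (simp add: image_mult_atLeastAtMost_if')
    finally show ?thesis .
  qed
  have h1: "h 1 = q" and h0: "h 0 = p" by (simp_all add: h_def)
  have gcont: "continuous_on {0..1} (\<lambda>t. f (h t))"
  proof (rule continuous_on_compose2[OF cont])
    show "continuous_on {0..1} h" unfolding h_def by (intro continuous_intros)
    show "h ` {0..1} \<subseteq> closed_segment p q" using seg[of 1] h1 by simp
  qed
  \<comment> \<open>The least element of this compact set is the first parameter with a nonpositive
    value; the intermediate value theorem makes that value 0.\<close>
  define Z where "Z = {t \<in> {0..1}. f (h t) \<le> 0}"
  have "closed Z" unfolding Z_def
    by (rule continuous_on_closed_Collect_le[OF gcont]) (auto intro: continuous_intros)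
  then have "compact Z"
    unfolding compact_eq_bounded_closed Z_def by (auto intro: bounded_subset[of "{0..1}"])
  moreover have "Z \<noteq> {}" using \<open>f q \<le> 0\<close> h1 unfolding Z_def by (auto intro!: exI[of _ 1])
  ultimately obtain s where s: "s \<in> Z" "\<And>t. t \<in> Z \<Longrightarrow> s \<le> t"
    using compact_attains_inf[of Z] by metis
  have s01: "0 \<le> s" "s \<le> 1" "f (h s) \<le> 0" using s(1) by (auto simp: Z_def)
  have "\<exists>t. 0 \<le> t \<and> t \<le> s \<and> f (h t) = 0"
  proof (rule IVT2')
    show "continuous_on {0..s} (\<lambda>t. f (h t))"
      using gcont by (rule continuous_on_subset) (use s01 in auto)
  qed (use s01 h0 \<open>0 \<le> f p\<close> in auto)
  then obtain t where t: "0 \<le> t" "t \<le> s" "f (h t) = 0" by blast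
  then have "t \<in> Z" using s01 by (simp add: Z_def)
  then have fs: "f (h s) = 0" using s(2)[of t] t by simp
  have nn: "0 \<le> f (h t)" if "0 \<le> t" "t \<le> s" for t
  proof (rule ccontr)
    assume neg: "\<not> 0 \<le> f (h t)"
    then have "t \<in> Z" using that s01 by (simp add: Z_def)
    then have "t = s" using s(2)[of t] that by simp
    then show False using neg fs by simp
  qed
  show ?thesis
  proof (rule that[of "h s"])
    have "h s \<in> h ` {0..1}" using s01 by auto
    then show "h s \<in> closed_segment p q" using seg[of 1] h1 by simp
    show "f (h s) = 0" by (rule fs)
    show "0 \<le> f x" if "x \<in> closed_segment p (h s)" for x
    proof -
      obtain t where "x = h t" "0 \<le> t" "t \<le> s"
        using \<open>x \<in> closed_segment p (h s)\<close> unfolding seg[OF s01(1)] by auto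
      then show ?thesis using nn by simp
    qed
  qed
qed

text \<open>The bound \<delta> is what monotonicity at the first step demands, as
  \<open>scaled x 2 = \<delta>\<close>. It makes the sets compact.\<close>

definition mono_upto :: "nat \<Rightarrow> real set" where
  "mono_upto N = {x \<in> {0..\<delta>}. \<forall>n\<le>N. scaled x n \<le> scaled x (Suc n)}"

lemma closed_mono_upto: "closed (mono_upto N)"
proof -
  have cont: "continuous_on {0..\<delta>} (\<lambda>x. scaled x n)" for n
    using continuous_on_scaled by (rule continuous_on_subset) auto
  have "closed {x \<in> {0..\<delta>}. scaled x n \<le> scaled x (Suc n)}" for n
    by (rule continuous_on_closed_Collect_le[OF cont cont]) simp
  moreover have "mono_upto N = (\<Inter>n\<in>{..N}. {x \<in> {0..\<delta>}. scaled x n \<le> scaled x (Suc n)})"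
    by (auto simp: mono_upto_def)
  ultimately show ?thesis by (auto intro: closed_INT)
qed

text \<open>The two flat steps at the ends give the next increment opposite signs there. Its zero
  nearest to \<open>p\<close> becomes the new \<open>p\<close>, the old \<open>p\<close> becomes the
  new \<open>q\<close>, and the increment is nonnegative between them.\<close>

lemma shooting_segment:
  "\<exists>p q. closed_segment p q \<subseteq> mono_upto (Suc N) \<and>
     scaled p (Suc N) = scaled p (Suc (Suc N)) \<and> scaled q N = scaled q (Suc N)"
proof (induction N)
  case 0
  have "closed_segment \<delta> 0 \<subseteq> mono_upto (Suc 0)"
    using \<delta>_pos by (auto simp: mono_upto_def closed_segment_eq_real_ivl le_Suc_eq)
  then show ?case by (intro exI[of _ \<delta>] exI[of _ 0]) simp
next
  case (Suc N)
  then obtain p q where seg: "closed_segment p q \<subseteq> mono_upto (Suc N)"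
    and p: "scaled p (Suc N) = scaled p (Suc (Suc N))" and q: "scaled q N = scaled q (Suc N)"
    by blast
  have pm: "p \<in> mono_upto (Suc N)" and qm: "q \<in> mono_upto (Suc N)" using seg by auto
  have p0: "0 \<le> p" and q0: "0 \<le> q" using pm qm by (auto simp: mono_upto_def)
  define f where "f x = scaled x (Suc (Suc (Suc N))) - scaled x (Suc (Suc N))" for x
  have "continuous_on {0..} f"
    unfolding f_def by (intro continuous_on_diff continuous_on_scaled)
  then have cont: "continuous_on (closed_segment p q) f"
    by (rule continuous_on_subset) (use seg in \<open>auto simp: mono_upto_def\<close>)
  have "0 \<le> f p"
    using p scaled_pos[OF p0, of N] \<delta>_pos by (simp add: f_def power2_eq_square del: scaled.simps(3))
      (simp add: power2_eq_square)
  \<comment> \<open>With v = \<open>scaled q (Suc N)\<close>, flatness makes the next value v plus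
    \<open>\<delta> ^ (2 * N + 1)\<close>; the one after it is at most v plus the smaller
    \<open>\<delta> ^ (2 * N + 3)\<close>.\<close>
  moreover have "f q \<le> 0"
  proof -
    have le: "scaled q (Suc N) \<le> scaled q (Suc (Suc N))" using qm by (auto simp: mono_upto_def)
    have "scaled q (Suc (Suc N)) = \<delta> ^ (2 * N + 1) + scaled q (Suc N)"
      using q by (simp add: power2_eq_square)
    moreover have "(scaled q (Suc N))\<^sup>2 / scaled q (Suc (Suc N)) \<le> scaled q (Suc N)"
    proof -
      have "(scaled q (Suc N))\<^sup>2 \<le> scaled q (Suc N) * scaled q (Suc (Suc N))"
        unfolding power2_eq_square using le scaled_ge(1)[OF q0] by (rule mult_left_mono)
      then show ?thesis using scaled_pos[OF q0, of N] by (simp add: pos_divide_le_eq del: scaled.simps)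
    qed
    moreover have "\<delta> ^ (2 * Suc N + 1) \<le> \<delta> ^ (2 * N + 1)"
      using \<delta>_pos \<delta>_less_1 by (intro power_decreasing) auto
    ultimately show ?thesis
      unfolding f_def scaled.simps(3)[of q "Suc N"] by linarith
  qed
  ultimately obtain c where c: "c \<in> closed_segment p q" "f c = 0"
    "\<And>x. x \<in> closed_segment p c \<Longrightarrow> 0 \<le> f x"
    using first_sign_change[OF cont] by blast
  have sub: "closed_segment p c \<subseteq> closed_segment p q"
    using c(1) by (simp add: subset_closed_segment)
  have "closed_segment c p \<subseteq> mono_upto (Suc (Suc N))"
  proof
    fix x assume "x \<in> closed_segment c p"
    then have x: "x \<in> closed_segment p c" by (simp add: closed_segment_commute)
    then have "x \<in> mono_upto (Suc N)" using sub seg by blast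
    moreover have "scaled x (Suc (Suc N)) \<le> scaled x (Suc (Suc (Suc N)))"
      using c(3)[OF x] by (simp add: f_def del: scaled.simps)
    ultimately show "x \<in> mono_upto (Suc (Suc N))"
      by (simp only: mono_upto_def le_Suc_eq[of _ "Suc N"]) blast
  qed
  then show ?case using c(2) p by (intro exI[of _ c] exI[of _ p]) (simp add: f_def del: scaled.simps)
qed

lemma monotone_profile_exists:
  obtains x where "0 < x" "mono (scaled x)"
proof -
  have "(\<Inter>N. mono_upto N) \<noteq> {}"
  proof (rule compact_nest)
    show "compact (mono_upto N)" for N
      using closed_mono_upto unfolding compact_eq_bounded_closed
      by (auto intro: bounded_subset[of "{0..\<delta>}"] simp: mono_upto_def)
    show anti: "mono_upto n \<subseteq> mono_upto m" if "m \<le> n" for m n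
      using that by (auto simp: mono_upto_def)
    show "mono_upto N \<noteq> {}" for N
      using shooting_segment[of N] anti[of N "Suc N"] by (metis ends_in_segment(1) empty_iff le_SucI order_refl subsetD)
  qed
  then obtain x where x: "\<And>N. x \<in> mono_upto N" by auto
  then have x0: "0 \<le> x" and le: "\<And>n. scaled x n \<le> scaled x (Suc n)" by (auto simp: mono_upto_def)
  \<comment> \<open>For \<open>x = 0\<close> the values at indices 2 and 3 are \<delta> and
    \<open>\<delta> ^ 3\<close>, a strict decrease.\<close>
  have "x \<noteq> 0"
  proof
    assume "x = 0"
    then have "\<delta> \<le> \<delta> ^ 3" using le[of "Suc (Suc 0)"] by (simp add: numeral_eq_Suc)
    moreover have "\<delta> * \<delta>\<^sup>2 < \<delta> * 1"
      using \<delta>_pos \<delta>_square_bounds(2) by (intro mult_strict_left_mono) auto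
    ultimately show False by (simp add: power3_eq_cube power2_eq_square)
  qed
  then show ?thesis using that[of x] x0 le by (simp add: mono_iff_le_Suc)
qed

section \<open>Convergence of the profile and bounds on its limit\<close>

text \<open>This is the recursion times \<open>(scaled x (Suc n))\<^sup>2\<close>. It telescopes, so
  the cube of the limit is an initial flux plus a series.\<close>

lemma scaled_flux:
  assumes "0 < x"
  shows "(scaled x (Suc n))\<^sup>2 * scaled x (Suc (Suc n)) =
    \<delta> ^ (2 * n + 1) * (scaled x (Suc n))\<^sup>2 + (scaled x n)\<^sup>2 * scaled x (Suc n)"
proof -
  have "scaled x (Suc n) \<noteq> 0"
    using assms scaled_pos[of x] by (cases n) (auto simp: less_imp_neq[symmetric] simp del: scaled.simps(3))
  then show ?thesis by (simp add: field_simps power2_eq_square)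
qed

text \<open>By monotonicity each increment is at most \<open>\<delta> ^ (2 * n + 1)\<close>. The
  added fraction is the geometric tail of these bounds, so the left side cannot grow with
  \<open>n\<close>.\<close>

lemma scaled_bounded:
  assumes "0 < x" "mono (scaled x)"
  shows "scaled x (Suc n) + \<delta> ^ (2 * n + 1) / (1 - \<delta>\<^sup>2) \<le> x + \<delta> / (1 - \<delta>\<^sup>2)"
proof (induction n)
  case (Suc n)
  have "(scaled x n)\<^sup>2 / scaled x (Suc n) \<le> scaled x (Suc n)"
  proof (cases "scaled x (Suc n) = 0")
    case False
    then have pos: "0 < scaled x (Suc n)" using scaled_ge(1)[of x "Suc n"] assms(1) by simp
    have "scaled x n \<le> scaled x (Suc n)" using assms(2) by (simp add: monoD)
    then have "(scaled x n)\<^sup>2 \<le> (scaled x (Suc n))\<^sup>2"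
      using scaled_ge(1)[of x n] assms(1) by (intro power_mono) auto
    then show ?thesis using pos by (simp add: pos_divide_le_eq power2_eq_square)
  qed simp
  moreover have "\<delta> ^ (2 * n + 1) + \<delta> ^ (2 * Suc n + 1) / (1 - \<delta>\<^sup>2) = \<delta> ^ (2 * n + 1) / (1 - \<delta>\<^sup>2)"
    using \<delta>_square_bounds by (simp add: field_simps power2_eq_square)
  ultimately show ?case using Suc by simp
qed simp

lemma scaled_limit:
  assumes "0 < x" "mono (scaled x)"
  obtains L where "scaled x \<longlonglongrightarrow> L" "\<And>n. scaled x n \<le> L" "1 < L" "L < 5 / 4"
proof -
  have "scaled x n \<le> x + \<delta> / (1 - \<delta>\<^sup>2)" for n
  proof -
    have "scaled x n \<le> scaled x (Suc n)" using assms(2) by (simp add: monoD)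
    moreover have "0 \<le> \<delta> ^ (2 * n + 1) / (1 - \<delta>\<^sup>2)" using \<delta>_pos \<delta>_square_bounds(2) by simp
    ultimately show ?thesis using scaled_bounded[OF assms, of n] by linarith
  qed
  then obtain L where lim: "scaled x \<longlonglongrightarrow> L" and le: "\<And>n. scaled x n \<le> L"
    using incseq_convergent[of "scaled x"] assms(2) by blast
  \<comment> \<open>Summation starts at index 2, where the profile has the known value
    \<delta>.\<close>
  define W where "W n = (scaled x n)\<^sup>2 * scaled x (Suc n)" for n
  define l where "l = \<delta>\<^sup>2"
  have l: "0.62 < l" "l < 0.63" using \<delta>_square_bounds by (simp_all add: l_def)
  have u2: "scaled x 2 = \<delta>" by (simp add: numeral_eq_Suc)
  have d5: "\<delta> ^ 5 = l / 2"
    using power_add[of \<delta> 3 2] by (simp add: \<delta>_cubed l_def)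
  have pw: "\<delta> ^ (2 * (2 + n) + 1) = l / 2 * l ^ n" for n
  proof -
    have "\<delta> ^ (2 * (2 + n) + 1) = \<delta> ^ 5 * \<delta> ^ (2 * n)"
      unfolding power_add[symmetric] by (rule arg_cong[of _ _ "\<lambda>k. \<delta> ^ k"]) simp
    then show ?thesis by (simp add: d5 l_def power_mult)
  qed
  have step: "W (Suc (2 + n)) = W (2 + n) + l / 2 * l ^ n * (scaled x (3 + n))\<^sup>2" for n
    using scaled_flux[OF assms(1), of "2 + n"] unfolding pw W_def by (simp add: numeral_3_eq_3 numeral_2_eq_2)
  have geo: "l / 2 * l ^ n + l / 2 * l ^ Suc n / (1 - l) = l / 2 * l ^ n / (1 - l)" for n
    using l by (simp add: field_simps)
  \<comment> \<open>Each source contains a squared profile value, here at least \<open>l\<close> and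
    in \<open>upper\<close> at most \<open>L\<^sup>2\<close>. The geometric tails again make the two
    sides comparable by induction.\<close>
  have lower: "W 2 + l * (l / 2 / (1 - l)) \<le> W (2 + n) + l * (l / 2 * l ^ n / (1 - l))" for n
  proof (induction n)
    case (Suc n)
    have "\<delta> \<le> scaled x (3 + n)" using monoD[OF assms(2), of 2 "3 + n"] u2 by simp
    then have "l \<le> (scaled x (3 + n))\<^sup>2" using \<delta>_pos unfolding l_def by (intro power_mono) auto
    then have "l / 2 * l ^ n * l \<le> l / 2 * l ^ n * (scaled x (3 + n))\<^sup>2"
      using l by (intro mult_left_mono) auto
    then show ?case
      using Suc step[of n] arg_cong[OF geo[of n], of "\<lambda>z. z * l"]
      by (simp add: algebra_simps)
  qed simp
  have upper: "W (2 + n) + L\<^sup>2 * (l / 2 * l ^ n / (1 - l)) \<le> W 2 + L\<^sup>2 * (l / 2 / (1 - l))" for n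
  proof (induction n)
    case (Suc n)
    have "(scaled x (3 + n))\<^sup>2 \<le> L\<^sup>2"
      using le scaled_ge(1)[of x] assms(1) by (intro power_mono) auto
    then have "l / 2 * l ^ n * (scaled x (3 + n))\<^sup>2 \<le> l / 2 * l ^ n * L\<^sup>2"
      using l by (intro mult_left_mono) auto
    then show ?case
      using Suc step[of n] arg_cong[OF geo[of n], of "\<lambda>z. z * L\<^sup>2"]
      by (simp add: algebra_simps)
  qed simp
  have "W \<longlonglongrightarrow> L\<^sup>2 * L"
    unfolding W_def by (intro tendsto_intros lim LIMSEQ_Suc)
  then have Wlim: "(\<lambda>n. W (2 + n)) \<longlonglongrightarrow> L ^ 3"
    using LIMSEQ_ignore_initial_segment[of W _ 2] by (simp add: add.commute power2_eq_square power3_eq_cube)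
  have zero: "(\<lambda>n. c * (l / 2 * l ^ n / (1 - l))) \<longlonglongrightarrow> 0" for c
  proof -
    have "(\<lambda>n. l ^ n) \<longlonglongrightarrow> 0" using l by (intro LIMSEQ_power_zero) simp
    from tendsto_mult[OF tendsto_const[of "c * (l / 2 / (1 - l))"] this] show ?thesis
      by (simp add: mult.assoc)
  qed
  have L_lower: "W 2 + l * (l / 2 / (1 - l)) \<le> L ^ 3"
    using LIMSEQ_le_const[OF tendsto_add[OF Wlim zero[of l]], of "W 2 + l * (l / 2 / (1 - l))"]
      lower by auto
  have L_upper: "L ^ 3 \<le> W 2 + L\<^sup>2 * (l / 2 / (1 - l))"
    using LIMSEQ_le_const2[OF tendsto_add[OF Wlim zero[of "L\<^sup>2"]], of "W 2 + L\<^sup>2 * (l / 2 / (1 - l))"]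
      upper by auto
  define y where "y = scaled x 3"
  have W2: "W 2 = l * y" using u2 by (simp add: W_def l_def y_def)
  have y_ge: "\<delta> \<le> y" using monoD[OF assms(2), of 2 3] u2 by (simp add: y_def)
  have "1 / 2 \<le> W 2"
  proof -
    have "l * \<delta> \<le> W 2" unfolding W2 using y_ge l by simp
    then show ?thesis using \<delta>_cubed by (simp add: l_def power2_eq_square power3_eq_cube)
  qed
  \<comment> \<open>This amounts to 1 - l < l^2, which the bound 0.62 ensures.\<close>
  moreover have "1 / 2 < l * (l / 2 / (1 - l))"
  proof -
    have "1 - l < l * l" using mult_strict_mono[OF l(1) l(1)] l by simp
    then show ?thesis using l by (simp add: field_simps)
  qed
  ultimately have "1 < L ^ 3" using L_lower by linarith
  have "0 \<le> L" using le[of 0] by simp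
  have "1 < L"
  proof (rule ccontr)
    assume "\<not> 1 < L"
    then have "L ^ 3 \<le> 1" using \<open>0 \<le> L\<close> by (intro power_le_one) auto
    then show False using \<open>1 < L ^ 3\<close> by simp
  qed
  have y0: "0 < y" using y_ge \<delta>_pos by simp
  have "y \<le> \<delta> ^ 5 + \<delta>\<^sup>2 / y"
  proof -
    have "scaled x 4 = \<delta> ^ 5 + (scaled x 2)\<^sup>2 / scaled x 3"
      using scaled.simps(3)[of x 2] by (simp add: numeral_eq_Suc)
    moreover have "y \<le> scaled x 4" unfolding y_def using assms(2) by (simp add: monoD)
    ultimately show ?thesis by (simp add: u2 y_def)
  qed
  then have ysq: "y * y \<le> l / 2 * y + l" using y0 by (simp add: d5 l_def[symmetric] field_simps)
  \<comment> \<open>The constant lies just above the positive root, about 0.967, of y^2 = 0.315 y +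
    0.63, the case l = 0.63 of \<open>ysq\<close>.\<close>
  have "y \<le> 0.968"
  proof (rule ccontr)
    assume "\<not> y \<le> 0.968"
    then have y: "0.968 < y" by simp
    have "y * y \<le> 0.315 * y + 0.63"
    proof -
      have "l / 2 * y \<le> 0.315 * y" using l y0 by (intro mult_right_mono) auto
      then show ?thesis using ysq l by linarith
    qed
    moreover have "0.968 * (0.968 - 0.315) < y * (y - 0.315)"
      using y by (intro mult_strict_mono) auto
    ultimately show False by (simp add: algebra_simps)
  qed
  then have W2_le: "W 2 \<le> 0.63 * 0.968" unfolding W2 using l y0 by (intro mult_mono) auto
  have frac: "l / 2 / (1 - l) \<le> 0.852" using l by (simp add: field_simps)
  \<comment> \<open>\<open>L_upper\<close> bounds L^2 (L - 0.852) by about 0.610, while this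
    increasing expression is already about 0.622 at 5/4.\<close>
  have "L < 5 / 4"
  proof (rule ccontr)
    assume "\<not> L < 5 / 4"
    then have L: "5 / 4 \<le> L" by simp
    have "L\<^sup>2 * (l / 2 / (1 - l)) \<le> L\<^sup>2 * 0.852" using frac by (intro mult_left_mono) auto
    then have "L\<^sup>2 * (L - 0.852) \<le> 0.63 * 0.968"
      using L_upper W2_le by (simp add: algebra_simps power2_eq_square power3_eq_cube)
    moreover have "(5 / 4)\<^sup>2 * (5 / 4 - 0.852) \<le> L\<^sup>2 * (L - 0.852)"
      using L by (intro mult_mono power_mono) auto
    ultimately show False by (simp add: power2_eq_square)
  qed
  show ?thesis using that lim le \<open>1 < L\<close> \<open>L < 5 / 4\<close> by blast
qed

text \<open>The identity \<open>one\<close>, that is \<open>\<delta> ^ 3 = 1 / 2\<close>, cancels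
  the powers of two.\<close>

lemma coeff_eq_scaled:
  assumes "0 < x"
  shows "coeff_eq (\<lambda>n. \<delta> ^ n * scaled x n)"
  unfolding coeff_eq_def
proof (intro conjI allI)
  fix n
  have ne: "scaled x (Suc n) \<noteq> 0"
    using assms scaled_pos[of x] by (cases n) (auto simp: less_imp_neq[symmetric] simp del: scaled.simps(3))
  have one: "2 ^ k * \<delta> ^ (3 * k) = 1" for k
    by (simp add: power_mult \<delta>_cubed flip: power_mult_distrib)
  have "2 ^ Suc n * (\<delta> ^ Suc n * scaled x (Suc n)) * (\<delta> ^ Suc (Suc n) * scaled x (Suc (Suc n)))
    = 2 ^ Suc n * \<delta> ^ (2 * n + 3) * (scaled x (Suc n) * scaled x (Suc (Suc n)))"
  proof -
    have "\<delta> ^ Suc n * \<delta> ^ Suc (Suc n) = \<delta> ^ (2 * n + 3)"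
      unfolding power_add[symmetric] by (rule arg_cong[of _ _ "\<lambda>k. \<delta> ^ k"]) simp
    moreover have "c * (p * u) * (q * v) = c * (p * q) * (u * v)" for c p q u v :: real
      by simp
    ultimately show ?thesis by metis
  qed
  also have "2 ^ Suc n * \<delta> ^ (2 * n + 3) = 2 ^ n * \<delta> ^ (2 * n)"
    by (simp add: power_add \<delta>_cubed)
  also have "scaled x (Suc n) * scaled x (Suc (Suc n)) =
      \<delta> ^ (2 * n + 1) * scaled x (Suc n) + (scaled x n)\<^sup>2"
    using ne by (simp add: field_simps)
  also have "2 ^ n * \<delta> ^ (2 * n) * (\<delta> ^ (2 * n + 1) * scaled x (Suc n) + (scaled x n)\<^sup>2) =
      2 ^ n * \<delta> ^ (3 * n) * \<delta> ^ Suc n * scaled x (Suc n) + 2 ^ n * (\<delta> ^ n * scaled x n)\<^sup>2"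
  proof -
    have "\<delta> ^ (2 * n) * \<delta> ^ (2 * n + 1) = \<delta> ^ (3 * n) * \<delta> ^ Suc n"
      unfolding power_add[symmetric] by (rule arg_cong[of _ _ "\<lambda>k. \<delta> ^ k"]) simp
    moreover have "\<delta> ^ (2 * n) = (\<delta> ^ n)\<^sup>2" by (simp add: power_mult[symmetric] mult.commute)
    moreover have "c * p * (q * u + v) = c * (p * q) * u + c * (p * v)" for c p q u v :: real
      by (simp add: algebra_simps)
    ultimately show ?thesis by (simp only: power_mult_distrib)
  qed
  finally show "2 ^ Suc n * (\<delta> ^ Suc n * scaled x (Suc n)) * (\<delta> ^ Suc (Suc n) * scaled x (Suc (Suc n))) =
      \<delta> ^ Suc n * scaled x (Suc n) + 2 ^ n * (\<delta> ^ n * scaled x n)\<^sup>2"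
    unfolding one by (simp only: mult_1)
qed simp

subsection \<open>Shifted solutions\<close>

text \<open>An index shift by \<open>k\<close> changes the weights by \<open>2 ^ k\<close>;
  rescaling the sequence absorbs this factor because the remaining term is linear.\<close>

lemma coeff_eq_scale_up:
  assumes "coeff_eq a" "a k = 0"
  shows "coeff_eq (\<lambda>n. 2 ^ k * a (n + k))"
  unfolding coeff_eq_def
proof (intro conjI allI)
  fix n
  have "2 ^ Suc n * (2 ^ k * a (Suc n + k)) * (2 ^ k * a (Suc (Suc n) + k)) =
     2 ^ k * (2 ^ Suc (n + k) * a (Suc (n + k)) * a (Suc (Suc (n + k))))"
    by (simp add: power_add)
  also have "\<dots> = 2 ^ k * a (Suc n + k) + 2 ^ n * (2 ^ k * a (n + k))\<^sup>2"
    unfolding coeff_eqD[OF assms(1)] by (simp add: power_add algebra_simps power2_eq_square)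
  finally show "2 ^ Suc n * (2 ^ k * a (Suc n + k)) * (2 ^ k * a (Suc (Suc n) + k)) =
     2 ^ k * a (Suc n + k) + 2 ^ n * (2 ^ k * a (n + k))\<^sup>2" .
qed (use assms in simp)

text \<open>Truncated subtraction and \<open>a 0 = 0\<close> make the first \<open>k\<close> coefficients vanish.\<close>

lemma coeff_eq_shift:
  assumes "coeff_eq a"
  shows "coeff_eq (\<lambda>n. a (n - k) / 2 ^ k)"
  unfolding coeff_eq_def
proof (intro conjI allI)
  have a0: "a 0 = 0" using assms by (simp add: coeff_eq_def)
  then show "a (0 - k) / 2 ^ k = 0" by simp
  fix n
  show "2 ^ Suc n * (a (Suc n - k) / 2 ^ k) * (a (Suc (Suc n) - k) / 2 ^ k) =
    a (Suc n - k) / 2 ^ k + 2 ^ n * (a (n - k) / 2 ^ k)\<^sup>2"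
  proof (cases "k \<le> n")
    case True
    then obtain j where n: "n = j + k" by (metis add.commute le_iff_add)
    have "2 ^ Suc n * (a (Suc n - k) / 2 ^ k) * (a (Suc (Suc n) - k) / 2 ^ k) =
      (2 ^ Suc j * a (Suc j) * a (Suc (Suc j))) / 2 ^ k"
      by (simp add: n power_add Suc_diff_le)
    also have "\<dots> = a (Suc n - k) / 2 ^ k + 2 ^ n * (a (n - k) / 2 ^ k)\<^sup>2"
      unfolding coeff_eqD[OF assms]
      by (simp add: n power_add Suc_diff_le add_divide_distrib power2_eq_square)
    finally show ?thesis .
  qed (use a0 in simp)
qed

lemma finite_energy_iff: "finite_energy a \<longleftrightarrow> summable (\<lambda>n. (a n)\<^sup>2)"
  unfolding finite_energy_def by (rule summable_Suc_iff)

lemma finite_energy_tendsto_0: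
  assumes "finite_energy a"
  shows "a \<longlonglongrightarrow> 0"
proof -
  have "(\<lambda>n. (a n)\<^sup>2) \<longlonglongrightarrow> 0"
    using assms unfolding finite_energy_iff by (rule summable_LIMSEQ_zero)
  from tendsto_real_sqrt[OF this] show ?thesis
    by (simp add: tendsto_rabs_zero_iff)
qed

text \<open>Removing the zeros and rescaling reduces to a nonzero first coefficient, where
  uniqueness identifies the result with \<open>s\<close>. One equivalence thus yields existence and
  uniqueness for all \<open>k\<close> and \<open>t0\<close>.\<close>

lemma positive_with_leading_zeros_iff:
  assumes s: "coeff_eq s" "\<And>n. 0 \<le> s n" "s 1 \<noteq> 0" "finite_energy s"
  shows "positive_finite_energy_self_similar t0 a \<and> (\<forall>i\<in>{1..k}. a i = 0) \<and> a (k + 1) \<noteq> 0 \<longleftrightarrow>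
    a = (\<lambda>n. s (n - k) / 2 ^ k)"
proof
  assume "positive_finite_energy_self_similar t0 a \<and> (\<forall>i\<in>{1..k}. a i = 0) \<and> a (k + 1) \<noteq> 0"
  then have a: "coeff_eq a" "\<And>n. 0 \<le> a n" "finite_energy a"
    and zeros: "\<forall>i\<in>{1..k}. a i = 0" and ne: "a (k + 1) \<noteq> 0"
    by (auto simp: positive_finite_energy_self_similar_def self_similar_solution_iff)
  have zero: "a n = 0" if "n \<le> k" for n
    using that zeros a(1) by (cases "n = 0") (auto simp: coeff_eq_def)
  have "(\<lambda>n. 2 ^ k * a (n + k)) = s"
  proof (rule coeff_unique)
    show "coeff_eq (\<lambda>n. 2 ^ k * a (n + k))" using a(1) zero[of k] by (simp add: coeff_eq_scale_up)
    show "(\<lambda>n. 2 ^ k * a (n + k)) \<longlonglongrightarrow> 0"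
      using tendsto_mult[OF tendsto_const
          LIMSEQ_ignore_initial_segment[OF finite_energy_tendsto_0[OF a(3)], of k], of "2 ^ k"] by simp
  qed (use a ne s finite_energy_tendsto_0[OF s(4)] in \<open>auto simp: add.commute\<close>)
  then have eq: "s n = 2 ^ k * a (n + k)" for n by auto
  show "a = (\<lambda>n. s (n - k) / 2 ^ k)"
  proof
    fix n
    show "a n = s (n - k) / 2 ^ k"
      by (cases "k \<le> n") (simp_all add: eq zero)
  qed
next
  assume a: "a = (\<lambda>n. s (n - k) / 2 ^ k)"
  have s0: "s 0 = 0" using s(1) by (simp add: coeff_eq_def)
  have "summable (\<lambda>n. (s n)\<^sup>2 / (2 ^ k)\<^sup>2)"
    using s(4) unfolding finite_energy_iff by (rule summable_divide)
  then have "summable (\<lambda>n. (a (n + k))\<^sup>2)" by (simp add: a power_divide)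
  then have "finite_energy a"
    using summable_iff_shift[of "\<lambda>n. (a n)\<^sup>2" k] by (simp add: finite_energy_iff)
  moreover have "coeff_eq a" unfolding a using s(1) by (rule coeff_eq_shift)
  ultimately show "positive_finite_energy_self_similar t0 a \<and> (\<forall>i\<in>{1..k}. a i = 0) \<and> a (k + 1) \<noteq> 0"
    using s(2,3) s0 by (auto simp: positive_finite_energy_self_similar_def self_similar_solution_iff a)
qed

theorem theorem10:
  shows "\<exists>R::real. 4 / 5 < R \<and> R < 1 \<and>
    (\<forall>t0<0.
       (\<exists>!a. positive_finite_energy_self_similar t0 a \<and> a 1 \<noteq> 0) \<and>
       (\<forall>n0::nat.
          (\<exists>!a. positive_finite_energy_self_similar t0 a \<and>
                 (\<forall>i\<in>{1..n0}. a i = 0) \<and> a (n0 + 1) \<noteq> 0) \<and>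
          (\<forall>a. positive_finite_energy_self_similar t0 a \<and>
                 (\<forall>i\<in>{1..n0}. a i = 0) \<and> a (n0 + 1) \<noteq> 0 \<longrightarrow>
               (\<lambda>n. a n / dyadic_k n powr (- (1 / 3)))
                 \<longlonglongrightarrow> 2 powr (- (2 * real n0 / 3)) * inverse R)))"
proof -
  obtain x where x: "0 < x" "mono (scaled x)" by (rule monotone_profile_exists)
  obtain L where lim: "scaled x \<longlonglongrightarrow> L" and le: "\<And>n. scaled x n \<le> L" and L: "1 < L" "L < 5 / 4"
    using scaled_limit[OF x] by blast
  define s where "s n = \<delta> ^ n * scaled x n" for n
  have s_nonneg: "0 \<le> s n" for n using scaled_ge(1)[of x n] x \<delta>_pos by (simp add: s_def)
  have "coeff_eq s" unfolding s_def using x(1) by (rule coeff_eq_scaled)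
  moreover have "s 1 \<noteq> 0" using x \<delta>_pos by (simp add: s_def)
  moreover have "finite_energy s"
    unfolding finite_energy_iff
  proof (rule summable_comparison_test')
    show "summable (\<lambda>n. L\<^sup>2 * (\<delta>\<^sup>2) ^ n)"
      using \<delta>_square_bounds by (intro summable_mult summable_geometric) simp
    show "norm ((s n)\<^sup>2) \<le> L\<^sup>2 * (\<delta>\<^sup>2) ^ n" for n
    proof -
      have "(scaled x n)\<^sup>2 \<le> L\<^sup>2" using le scaled_ge(1)[of x n] x by (intro power_mono) auto
      then have "(\<delta> ^ n)\<^sup>2 * (scaled x n)\<^sup>2 \<le> (\<delta> ^ n)\<^sup>2 * L\<^sup>2" by (intro mult_left_mono) auto
      moreover have "norm ((s n)\<^sup>2) = (\<delta> ^ n)\<^sup>2 * (scaled x n)\<^sup>2"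
        by (simp only: s_def real_norm_def power_mult_distrib) (rule abs_of_nonneg, simp)
      moreover have "(\<delta> ^ n)\<^sup>2 * L\<^sup>2 = L\<^sup>2 * (\<delta>\<^sup>2) ^ n"
        by (simp add: power_mult[symmetric] mult.commute)
      ultimately show ?thesis by linarith
    qed
  qed
  ultimately have char: "positive_finite_energy_self_similar t0 a \<and> (\<forall>i\<in>{1..k}. a i = 0) \<and> a (k + 1) \<noteq> 0
      \<longleftrightarrow> a = (\<lambda>n. s (n - k) / 2 ^ k)" for t0 a k
    using s_nonneg by (intro positive_with_leading_zeros_iff) auto
  have char0: "positive_finite_energy_self_similar t0 a \<and> a 1 \<noteq> 0 \<longleftrightarrow> a = s" for t0 a
    using char[of t0 a 0] by simp
  \<comment> \<open>The factor \<open>2 ^ k\<close> from the shift and \<open>\<delta> ^ k\<close>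
    from the index offset multiply to 2 to the power 2k/3, the denominator of the limit
    constant.\<close>
  have asym: "(\<lambda>n. s (n - k) / 2 ^ k / dyadic_k n powr (- (1 / 3))) \<longlonglongrightarrow> 2 powr (- (2 * real k / 3)) * L"
    for k
  proof (rule LIMSEQ_offset[of _ k])
    have "s n / 2 ^ k / dyadic_k (n + k) powr (- (1 / 3)) = 2 powr (- (2 * real k / 3)) * scaled x n" for n
    proof -
      have "dyadic_k (n + k) powr (- (1 / 3)) = \<delta> ^ (n + k)"
        by (simp add: dyadic_k_def \<delta>_power powr_realpow[symmetric] powr_powr)
      then have k: "dyadic_k (n + k) powr (- (1 / 3)) = \<delta> ^ n * \<delta> ^ k"
        by (simp add: power_add)
      have "2 ^ k * \<delta> ^ (3 * k) = 1"
        by (simp add: power_mult \<delta>_cubed flip: power_mult_distrib)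
      moreover have "\<delta> ^ (3 * k) = 2 powr (- (2 * real k / 3)) * \<delta> ^ k"
        using \<delta>_power[of "2 * k"] power_add[of \<delta> "2 * k" k] by simp
      ultimately have "2 powr (- (2 * real k / 3)) * (2 ^ k * \<delta> ^ k) = 1"
        by (simp add: mult.left_commute)
      then have "2 powr (- (2 * real k / 3)) = 1 / (2 ^ k * \<delta> ^ k)"
        using \<delta>_pos by (simp add: eq_divide_eq)
      then show ?thesis using \<delta>_pos unfolding k s_def by simp
    qed
    then show "(\<lambda>n. s (n + k - k) / 2 ^ k / dyadic_k (n + k) powr (- (1 / 3)))
        \<longlonglongrightarrow> 2 powr (- (2 * real k / 3)) * L"
      using tendsto_mult[OF tendsto_const lim] by simp
  qed
  have "4 / 5 < inverse L" "inverse L < 1" using L by (simp_all add: field_simps)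
  then show ?thesis
    unfolding char char0 using asym by (intro exI[of _ "inverse L"]) simp
qed

end
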